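(* Every $(4K_1, C_4, P_6)$-free graph that contains $C_6$ as an induced subgraph has clique-width at most $27$. (In particular, the class of $(4K_1, C_4, P_6)$-free graphs that contain a $C_6$ has bounded clique-width.)
   Context: Graphs are finite and simple. For a set $L$ of graphs, a graph $G$ is $L$-free if it contains no induced subgraph isomorphic to a member of $L$. $4K_1$ is the edgeless graph on four vertices, $C_k$ is the chordless cycle on $k$ vertices, and $P_k$ is the chordless path on $k$ vertices. The clique-width of a graph $G$ is the minimum number of labels needed to build $G$ (with labels forgotten at the end) by the following four operations: (1) create a vertex with label $i$; (2) take the disjoint union of two previously constructed labelled graphs; (3) for some $i \neq j$, join by an edge every vertex with label $i$ to every vertex with label $j$; (4) relabel all vertices with label $i$ by label $j$. *)

theory Defs
  imports "Graph_Theory.Graph_Theory" "HOL-Library.Extended_Nat"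
begin

text \<open>
  A finite simple graph is a \<^locale>\<open>pair_graph\<close>: a finite, symmetric, loop-free digraph
  whose arcs are ordered pairs of vertices, so that the undirected edge \<open>uv\<close> is represented by
  the two arcs \<open>(u, v)\<close> and \<open>(v, u)\<close>.
\<close>

definition contains_induced :: "'a pair_pre_digraph \<Rightarrow> 'b pair_pre_digraph \<Rightarrow> bool" where
  "contains_induced G F \<longleftrightarrow>
     (\<exists>H :: 'a pair_pre_digraph.
        induced_subgraph (with_proj H) (with_proj G) \<and> digraph_iso (with_proj H) (with_proj F))"

definition induced_free :: "'b pair_pre_digraph set \<Rightarrow> 'a pair_pre_digraph \<Rightarrow> bool" where
  "induced_free L G \<longleftrightarrow> (\<forall>F\<in>L. \<not> contains_induced G F)"

definition edgeless_graph :: "nat \<Rightarrow> nat pair_pre_digraph" where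
  "edgeless_graph n = \<lparr>pverts = {..<n}, parcs = {}\<rparr>"

text \<open>For \<open>k \<ge> 3\<close> this is the cycle on \<open>k\<close> vertices; smaller values of \<open>k\<close> are degenerate.\<close>

definition cycle_graph :: "nat \<Rightarrow> nat pair_pre_digraph" where
  "cycle_graph k = \<lparr>pverts = {..<k},
     parcs = {(i, j). i < k \<and> j < k \<and> (j = (i + 1) mod k \<or> i = (j + 1) mod k)}\<rparr>"

definition path_graph :: "nat \<Rightarrow> nat pair_pre_digraph" where
  "path_graph k = \<lparr>pverts = {..<k},
     parcs = {(i, j). i < k \<and> j < k \<and> (j = i + 1 \<or> i = j + 1)}\<rparr>"

text \<open>
  \<open>cw_built k G l\<close>: the graph \<open>G\<close> with vertex labelling \<open>l\<close> can be built by the four clique-width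
  operations using labels from \<open>{0..<k}\<close>. The values of \<open>l\<close> outside the vertex set of \<open>G\<close> are
  irrelevant. The operations produce graphs with named vertices; disjoint union requires the
  two vertex sets to be disjoint.
\<close>

inductive cw_built :: "nat \<Rightarrow> 'a pair_pre_digraph \<Rightarrow> ('a \<Rightarrow> nat) \<Rightarrow> bool" for k :: nat where
  create: "i < k \<Longrightarrow> cw_built k \<lparr>pverts = {v}, parcs = {}\<rparr> (\<lambda>_. i)"
| disjoint_union:
    "\<lbrakk>cw_built k G l; cw_built k H m; pverts G \<inter> pverts H = {}\<rbrakk> \<Longrightarrow>
     cw_built k \<lparr>pverts = pverts G \<union> pverts H, parcs = parcs G \<union> parcs H\<rparr>
       (\<lambda>v. if v \<in> pverts G then l v else m v)"
| join:
    "\<lbrakk>cw_built k G l; i < k; j < k; i \<noteq> j\<rbrakk> \<Longrightarrow>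
     cw_built k
       (G\<lparr>parcs := parcs G \<union>
          {(u, v). u \<in> pverts G \<and> v \<in> pverts G \<and> (l u = i \<and> l v = j \<or> l u = j \<and> l v = i)}\<rparr>) l"
| relabel:
    "\<lbrakk>cw_built k G l; i < k; j < k\<rbrakk> \<Longrightarrow>
     cw_built k G (\<lambda>v. if l v = i then j else l v)"

text \<open>
  The infimum over the extended naturals is a minimum for every nonempty finite graph; the
  empty graph cannot be built by the four operations and gets the value \<open>\<infinity>\<close>.
\<close>

definition clique_width :: "'a pair_pre_digraph \<Rightarrow> enat" where
  "clique_width G = Inf {enat k | k. \<exists>l. cw_built k G l}"

definition bounded_clique_width :: "'a pair_pre_digraph set \<Rightarrow> bool" where
  "bounded_clique_width \<G> \<longleftrightarrow> (\<exists>k::nat. \<forall>G\<in>\<G>. clique_width G \<le> enat k)"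

end

(*
  Fix an induced six-cycle. By 4K1, C4 and P6, a vertex off the cycle sees three or four consecutive
  cycle vertices, two antipodal ones, or all six. Sorting the vertices accordingly gives classes
  A i, B i, D i and F, all of them cliques; at most one pair of antipodal cycle vertices has a
  nonempty class D i. Two cliques in a C4-free graph form a chain graph, so ordering them by
  neighbourhood inclusion makes adjacency between them a matter of which vertex comes first.
  Cutting every A i and B i in two leaves at most 26 sets, any two of which are complete,
  anticomplete, or belong to such a chain, and different chains do not share vertices, so a single
  ranking of the vertices works for all of them. Inserting the vertices by increasing rank needs one label per set
  and one spare label.
*)
theory Submission
  imports Defs "HOL-Library.Numeral_Type"
begin

section \<open>Chain graphs and clique-width\<close>

text \<open>The neighbourhoods \<open>N y\<close> are nested. \<open>U x\<close> is the union of
  those that miss \<open>x\<close>, and each one that contains \<open>x\<close> strictly includes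
  \<open>U x\<close>, so comparing cardinalities decides adjacency.\<close>

lemma chain_rank:
  fixes E :: "'a \<Rightarrow> 'b \<Rightarrow> bool"
  assumes fin: "finite X"
    and chain: "\<And>x x' y y'. x \<in> X \<Longrightarrow> x' \<in> X \<Longrightarrow> y \<in> Y \<Longrightarrow> y' \<in> Y \<Longrightarrow>
       E x y \<Longrightarrow> E x' y' \<Longrightarrow> E x y' \<or> E x' y"
  obtains p :: "'a \<Rightarrow> nat" and q :: "'b \<Rightarrow> nat"
  where "\<And>x y. x \<in> X \<Longrightarrow> y \<in> Y \<Longrightarrow> (E x y \<longleftrightarrow> p x < q y) \<and> p x \<noteq> q y"
proof -
  define N where "N y = {x \<in> X. E x y}" for y
  define U where "U x = (\<Union>y \<in> {y \<in> Y. \<not> E x y}. N y)" for x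
  have finite_N: "finite (N y)" and finite_U: "finite (U x)" for x y
    using fin by (auto simp: N_def U_def intro: finite_subset[of _ X])
  have edge: "2 * card (U x) + 1 < 2 * card (N y)" if "x \<in> X" "y \<in> Y" "E x y" for x y
  proof -
    have "U x \<subseteq> N y"
      using chain that unfolding U_def N_def by blast
    moreover have "x \<in> N y" "x \<notin> U x"
      using that by (auto simp: U_def N_def)
    ultimately have "card (U x) < card (N y)"
      using finite_N by (metis psubsetI psubset_card_mono)
    then show ?thesis
      by simp
  qed
  have non_edge: "2 * card (N y) < 2 * card (U x) + 1" if "x \<in> X" "y \<in> Y" "\<not> E x y" for x y
  proof -
    have "N y \<subseteq> U x"
      using that by (auto simp: U_def)
    then show ?thesis
      using card_mono[OF finite_U[of x]] by (simp add: less_Suc_eq_le)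
  qed
  \<comment> \<open>Odd ranks on \<open>X\<close> and even ranks on \<open>Y\<close> exclude ties;
    the added one turns equal cardinalities into a non-edge.\<close>
  show thesis
    by (rule that[of "\<lambda>x. 2 * card (U x) + 1" "\<lambda>y. 2 * card (N y)"])
      (use edge non_edge in \<open>metis less_asym' less_irrefl\<close>)
qed

text \<open>One \<open>join\<close> per label in \<open>S\<close>: none of them changes a label, and
  leaving \<open>j\<close> out of \<open>S\<close> keeps the two labels of every join
  distinct.\<close>

lemma cw_built_joins:
  assumes "cw_built k G l" "finite S" "S \<subseteq> {..<k} - {j}" "j < k"
  shows "cw_built k (G\<lparr>parcs := parcs G \<union> {(u, v). u \<in> pverts G \<and> v \<in> pverts G \<and>
    (l u \<in> S \<and> l v = j \<or> l u = j \<and> l v \<in> S)}\<rparr>) l"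
  using assms(2,3)
proof (induction S rule: finite_induct)
  case empty
  then show ?case
    using assms(1) by simp
next
  case (insert i S)
  let ?G = "\<lambda>S. G\<lparr>parcs := parcs G \<union> {(u, v). u \<in> pverts G \<and> v \<in> pverts G \<and>
    (l u \<in> S \<and> l v = j \<or> l u = j \<and> l v \<in> S)}\<rparr>"
  have "cw_built k (?G S) l"
    using insert by simp
  from cw_built.join[OF this, of i j] insert.prems assms(4)
  have "cw_built k (?G S\<lparr>parcs := parcs (?G S) \<union> {(u, v). u \<in> pverts (?G S) \<and> v \<in> pverts (?G S) \<and>
    (l u = i \<and> l v = j \<or> l u = j \<and> l v = i)}\<rparr>) l"
    by simp
  also have "?G S\<lparr>parcs := parcs (?G S) \<union> {(u, v). u \<in> pverts (?G S) \<and> v \<in> pverts (?G S) \<and>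
    (l u = i \<and> l v = j \<or> l u = j \<and> l v = i)}\<rparr> = ?G (insert i S)"
    by (cases G) auto
  finally show ?case .
qed

text \<open>
  Add the vertices by increasing \<open>r\<close>: a new vertex gets a spare label \<open>m\<close>, is joined to the
  labels of its earlier neighbours, and then takes its own label.
\<close>

lemma cw_built_ranked:
  fixes R :: "'a rel" and r :: "'a \<Rightarrow> nat"
  assumes "finite W" "W \<noteq> {}"
    and "sym R" "irrefl R"
    and "\<And>v. v \<in> W \<Longrightarrow> lab v < m"
    and "\<And>u v w. u \<in> W \<Longrightarrow> v \<in> W \<Longrightarrow> w \<in> W \<Longrightarrow> lab u = lab v \<Longrightarrow> w \<noteq> u \<Longrightarrow> w \<noteq> v \<Longrightarrow>
      r u \<le> r w \<Longrightarrow> r v \<le> r w \<Longrightarrow> (u, w) \<in> R \<Longrightarrow> (v, w) \<in> R"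
  shows "\<exists>l. cw_built (Suc m) \<lparr>pverts = W, parcs = R \<inter> W \<times> W\<rparr> l \<and> (\<forall>v \<in> W. l v = lab v)"
  using assms(1,2,5,6)
proof (induction "card W" arbitrary: W)
  case 0
  then show ?case
    by simp
next
  case (Suc n)
  \<comment> \<open>A vertex of largest rank is split off, so that it is the last one
    inserted.\<close>
  have "Max (r ` W) \<in> r ` W"
    using Suc.prems(1,2) by simp
  then obtain w where w: "w \<in> W" "r w = Max (r ` W)"
    by auto
  then have w_max: "r v \<le> r w" if "v \<in> W" for v
    using Suc.prems(1) that by simp
  define W' where "W' = W - {w}"
  have W: "W = insert w W'" "w \<notin> W'" "finite W'"
    using w Suc.prems by (auto simp: W'_def)
  have lab_w: "lab w < m"
    using w Suc.prems by simp
  have loop: "(v, v) \<notin> R" for v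
    using assms(4) by (auto simp: irrefl_def)
  show ?case
  proof (cases "W' = {}")
    case True
    then have "\<lparr>pverts = W, parcs = R \<inter> W \<times> W\<rparr> = \<lparr>pverts = {w}, parcs = {}\<rparr>"
      using W loop by auto
    then show ?thesis
      using cw_built.create[of "lab w" "Suc m" w] lab_w W True by auto
  next
    case False
    let ?G = "\<lparr>pverts = W', parcs = R \<inter> W' \<times> W'\<rparr>"
    obtain l where l: "cw_built (Suc m) ?G l" "\<forall>v \<in> W'. l v = lab v"
    proof -
      have "\<exists>l. cw_built (Suc m) ?G l \<and> (\<forall>v \<in> W'. l v = lab v)"
      proof (rule Suc.hyps(1))
        show "n = card W'"
          using Suc.hyps(2) W by simp
        show "lab v < m" if "v \<in> W'" for v
          using Suc.prems(3) that W(1) by blast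
        show "(v, x) \<in> R" if "u \<in> W'" "v \<in> W'" "x \<in> W'" "lab u = lab v" "x \<noteq> u" "x \<noteq> v"
          "r u \<le> r x" "r v \<le> r x" "(u, x) \<in> R" for u v x
          by (rule Suc.prems(4)[of u v x]) (use that W(1) in simp_all)
      qed (use W False in simp_all)
      then show thesis
        using that by blast
    qed
    define l' where "l' v = (if v \<in> W' then l v else m)" for v
    define S where "S = lab ` {v \<in> W'. (v, w) \<in> R}"
    have l': "l' w = m" "\<And>v. v \<in> W' \<Longrightarrow> l' v = lab v" "\<And>v. v \<in> W' \<Longrightarrow> lab v < m"
      using l W Suc.prems(3) by (auto simp: l'_def)
    have "cw_built (Suc m) \<lparr>pverts = W, parcs = R \<inter> W' \<times> W'\<rparr> l'"
      using cw_built.disjoint_union[OF l(1) cw_built.create[of m "Suc m" w]] W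
      by (simp add: l'_def[abs_def])
    moreover have "finite S" "S \<subseteq> {..<Suc m} - {m}"
      using W l'(3) by (auto simp: S_def less_SucI)
    ultimately have "cw_built (Suc m) \<lparr>pverts = W, parcs = R \<inter> W' \<times> W' \<union>
        {(u, v). u \<in> W \<and> v \<in> W \<and> (l' u \<in> S \<and> l' v = m \<or> l' u = m \<and> l' v \<in> S)}\<rparr> l'"
      using cw_built_joins[of "Suc m" "\<lparr>pverts = W, parcs = R \<inter> W' \<times> W'\<rparr>" l' S m] by simp
    moreover have "R \<inter> W' \<times> W' \<union>
        {(u, v). u \<in> W \<and> v \<in> W \<and> (l' u \<in> S \<and> l' v = m \<or> l' u = m \<and> l' v \<in> S)} = R \<inter> W \<times> W"
    proof -
      \<comment> \<open>As \<open>w\<close> has the largest rank in \<open>W\<close>, vertices of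
        \<open>W'\<close> with equal labels agree on adjacency to \<open>w\<close>; joining whole
        labels therefore adds no wrong edge.\<close>
      have in_S: "lab v \<in> S \<longleftrightarrow> (v, w) \<in> R" if "v \<in> W'" for v
      proof
        assume "lab v \<in> S"
        then obtain u where "u \<in> W'" "(u, w) \<in> R" "lab u = lab v"
          by (auto simp: S_def)
        then show "(v, w) \<in> R"
          using Suc.prems(4)[of u v w] w(1) w_max that W by auto
      qed (use that in \<open>auto simp: S_def\<close>)
      have "m \<notin> S"
        using l'(3) by (auto simp: S_def)
      then have new: "l' u \<in> S \<and> l' v = m \<longleftrightarrow> v = w \<and> (u, w) \<in> R" if "u \<in> W" "v \<in> W" for u v
        using that W(1,2) l' in_S loop by (cases "u = w"; cases "v = w") force+
      have "(u, v) \<in> R \<longleftrightarrow> (v, u) \<in> R" for u v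
        using assms(3) by (auto dest: symD)
      then show ?thesis
        using new W by (auto; blast)
    qed
    ultimately have "cw_built (Suc m) \<lparr>pverts = W, parcs = R \<inter> W \<times> W\<rparr> l'"
      by simp
    \<comment> \<open>Relabelling frees the spare label \<open>m\<close> for the next
      vertex.\<close>
    then have "cw_built (Suc m) \<lparr>pverts = W, parcs = R \<inter> W \<times> W\<rparr>
        (\<lambda>v. if l' v = m then lab w else l' v)"
      using lab_w by (intro cw_built.relabel) auto
    moreover have "(if l' v = m then lab w else l' v) = lab v" if "v \<in> W" for v
      using that l'(1) l'(2)[of v] l'(3)[of v] W(1) by (cases "v = w") auto
    ultimately show ?thesis
      by blast
  qed
qed

section \<open>Induced subgraphs as embeddings\<close>

text \<open>The isomorphism sends a listed vertex to its position, so an induced copy is exhibited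
  by listing its vertices in order.\<close>

lemma contains_induced_list:
  assumes "pair_wf_digraph G"
    and F: "pverts F = {..<length xs}" "parcs F \<subseteq> {..<length xs} \<times> {..<length xs}"
    and xs: "distinct xs" "set xs \<subseteq> pverts G"
    and arcs: "\<And>i j. i < length xs \<Longrightarrow> j < length xs \<Longrightarrow>
      (xs ! i, xs ! j) \<in> parcs G \<longleftrightarrow> (i, j) \<in> parcs F"
  shows "contains_induced G F"
proof -
  let ?n = "length xs"
  define H where "H = \<lparr>pverts = set xs, parcs = parcs G \<inter> set xs \<times> set xs\<rparr>"
  define g where "g = inv_into {..<?n} ((!) xs)"
  have inj: "inj_on ((!) xs) {..<?n}"
    using xs(1) by (simp add: inj_on_nth)
  have g: "g (xs ! i) = i" if "i < ?n" for i
    unfolding g_def using inv_into_f_f[OF inj] that by simp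
  have in_xs: "\<exists>i < ?n. v = xs ! i" if "v \<in> set xs" for v
    using that by (metis in_set_conv_nth)
  have wf_H: "wf_digraph (with_proj H)" and wf_G: "wf_digraph (with_proj G)"
    using assms(1) by (auto simp: wf_digraph_wp_iff H_def pair_wf_digraph_def)
  have "induced_subgraph (with_proj H) (with_proj G)"
    unfolding induced_subgraph_def subgraph_def compatible_def
    using wf_H wf_G xs(2) by (auto simp: H_def)
  moreover have "digraph_iso (with_proj H) (with_proj F)"
  proof -
    \<comment> \<open>Applying the isomorphism must yield \<open>with_proj F\<close>, whose ends are
      the projections; this fixes the head and tail maps.\<close>
    let ?hom = "\<lparr>iso_verts = g, iso_arcs = map_prod g g, iso_head = snd, iso_tail = fst\<rparr>"
    have inj_g: "inj_on g (set xs)"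
      using in_xs g by (metis inj_onI)
    have "pre_digraph.digraph_isomorphism (with_proj H) ?hom"
      unfolding pre_digraph.digraph_isomorphism_def
      using wf_H inj_g inj_on_subset[OF map_prod_inj_on[OF inj_g inj_g]]
      by (auto simp: H_def)
    moreover have "with_proj F = app_iso ?hom (with_proj H)"
    proof -
      have "set xs = (!) xs ` {..<?n}"
        by (auto simp: set_conv_nth)
      then have "pverts F = g ` set xs"
        using F(1) g by (simp add: image_image)
      moreover have "parcs F = map_prod g g ` parcs H"
      proof (intro set_eqI iffI)
        fix e
        assume e: "e \<in> parcs F"
        then obtain i j where ij: "e = (i, j)" "i < ?n" "j < ?n"
          using F(2) by auto
        then have "(xs ! i, xs ! j) \<in> parcs H" "e = map_prod g g (xs ! i, xs ! j)"
          using arcs e g by (auto simp: H_def)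
        then show "e \<in> map_prod g g ` parcs H"
          by blast
      next
        fix e
        assume "e \<in> map_prod g g ` parcs H"
        then obtain u v where uv: "(u, v) \<in> parcs H" "e = (g u, g v)"
          by auto
        then obtain i j where "i < ?n" "u = xs ! i" "j < ?n" "v = xs ! j"
          using in_xs[of u] in_xs[of v] by (auto simp: H_def)
        then show "e \<in> parcs F"
          using uv arcs g by (auto simp: H_def)
      qed
      ultimately show ?thesis
        by (simp add: with_proj_def app_iso_def H_def)
    qed
    ultimately show ?thesis
      unfolding digraph_iso_def by blast
  qed
  ultimately show ?thesis
    unfolding contains_induced_def by blast
qed

text \<open>The embedding \<open>f\<close> inverts the vertex part of the isomorphism.\<close>

lemma contains_inducedE:
  assumes "contains_induced G F"
  obtains f where "inj_on f (pverts F)" "f ` pverts F \<subseteq> pverts G"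
    "\<And>i j. i \<in> pverts F \<Longrightarrow> j \<in> pverts F \<Longrightarrow> (f i, f j) \<in> parcs G \<longleftrightarrow> (i, j) \<in> parcs F"
proof -
  obtain H hom where H: "induced_subgraph (with_proj H) (with_proj G)"
    and hom: "pre_digraph.digraph_isomorphism (with_proj H) hom"
    and F: "with_proj F = app_iso hom (with_proj H)"
    using assms unfolding contains_induced_def digraph_iso_def by blast
  define f where "f = inv_into (pverts H) (iso_verts hom)"
  have F_verts: "pverts F = iso_verts hom ` pverts H" and F_arcs: "parcs F = iso_arcs hom ` parcs H"
    and ends: "iso_tail hom = fst" "iso_head hom = snd"
    using F by (auto simp: with_proj_def app_iso_def)
  have inj: "inj_on (iso_verts hom) (pverts H)"
    using hom unfolding pre_digraph.digraph_isomorphism_def by simp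
  \<comment> \<open>Both graphs have the projections as ends, so the vertex map determines the arc
    map.\<close>
  have arc: "iso_arcs hom e = (iso_verts hom (fst e), iso_verts hom (snd e))" if "e \<in> parcs H" for e
    using hom that unfolding pre_digraph.digraph_isomorphism_def
    by (auto simp: ends prod_eq_iff)
  have H_sub: "pverts H \<subseteq> pverts G" and H_wf: "pair_wf_digraph H"
    and H_arcs: "parcs H = {e \<in> parcs G. fst e \<in> pverts H \<and> snd e \<in> pverts H}"
    using H unfolding induced_subgraph_def subgraph_def by (auto simp: wf_digraph_wp_iff)
  have f_in: "f i \<in> pverts H" and f_inv: "iso_verts hom (f i) = i" if "i \<in> pverts F" for i
    using that inv_into_into[of i "iso_verts hom" "pverts H"] f_inv_into_f[of i "iso_verts hom" "pverts H"]
    by (simp_all add: f_def F_verts)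
  have f_left: "f (iso_verts hom v) = v" if "v \<in> pverts H" for v
    using that inj by (simp add: f_def)
  show thesis
  proof (rule that[of f])
    show "inj_on f (pverts F)"
      using f_inv by (metis inj_onI)
    show "f ` pverts F \<subseteq> pverts G"
      using f_in H_sub by blast
    show "(f i, f j) \<in> parcs G \<longleftrightarrow> (i, j) \<in> parcs F" if "i \<in> pverts F" "j \<in> pverts F" for i j
    proof
      assume "(f i, f j) \<in> parcs G"
      then have "(f i, f j) \<in> parcs H"
        using f_in that H_arcs by simp
      then show "(i, j) \<in> parcs F"
        using arc[of "(f i, f j)"] f_inv that F_arcs by (simp add: image_iff) metis
    next
      assume "(i, j) \<in> parcs F"
      then obtain e where e: "e \<in> parcs H" "(i, j) = iso_arcs hom e"
        using F_arcs by blast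
      then have "e = (f i, f j)"
        using arc[of e] H_arcs f_left by (auto simp: prod_eq_iff)
      then show "(f i, f j) \<in> parcs G"
        using e(1) H_arcs by simp
    qed
  qed
qed

section \<open>Vertices around an induced six-cycle\<close>

lemma six_cases:
  fixes j :: 6
  shows "j = 0 \<or> j = 1 \<or> j = 2 \<or> j = 3 \<or> j = 4 \<or> j = 5"
proof -
  obtain z where z: "j = of_int z" "0 \<le> z" "z < int CARD(6)"
    by (rule bit0_cases)
  then have "z \<in> {0, 1, 2, 3, 4, 5}"
    by auto
  with z(1) show ?thesis
    by auto
qed

text \<open>Instances of a lemma at a shifted index are normalised to offsets below six from the
  same \<open>i\<close>.\<close>

lemma six_add [simp]:
  fixes i :: 6
  shows "i + 1 + 1 = i + 2" "i + 1 + 2 = i + 3" "i + 1 + 3 = i + 4" "i + 1 + 4 = i + 5" "i + 1 + 5 = i"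
    "i + 2 + 1 = i + 3" "i + 2 + 2 = i + 4" "i + 2 + 3 = i + 5" "i + 2 + 4 = i" "i + 2 + 5 = i + 1"
    "i + 3 + 1 = i + 4" "i + 3 + 2 = i + 5" "i + 3 + 3 = i" "i + 3 + 4 = i + 1" "i + 3 + 5 = i + 2"
    "i + 4 + 1 = i + 5" "i + 4 + 2 = i" "i + 4 + 3 = i + 1" "i + 4 + 4 = i + 2" "i + 4 + 5 = i + 3"
    "i + 5 + 1 = i" "i + 5 + 2 = i + 1" "i + 5 + 3 = i + 2" "i + 5 + 4 = i + 3" "i + 5 + 5 = i + 4"
  by simp_all

lemma six_reduce:
  "(6::6) = 0" "(7::6) = 1" "(8::6) = 2" "(9::6) = 3" "(10::6) = 4"
  by simp_all

lemma six_offset_cases: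
  fixes i j :: 6
  obtains "j = i" | "j = i + 1" | "j = i + 2" | "j = i + 3" | "j = i + 4" | "j = i + 5"
  using six_cases[of "j - i"] by (auto simp: diff_eq_eq add.commute)

text \<open>
  The relation \<open>E\<close> is adjacency made reflexive: then each forbidden induced subgraph becomes a
  condition without distinctness side conditions.
\<close>

locale hexagon_graph =
  fixes V :: "'a set" and E :: "'a \<Rightarrow> 'a \<Rightarrow> bool" and h :: "6 \<Rightarrow> 'a"
  assumes fin: "finite V"
    and E_refl: "E x x"
    and E_sym: "E x y \<Longrightarrow> E y x"
    and C4: "E p q \<Longrightarrow> E q r \<Longrightarrow> E r s \<Longrightarrow> E s p \<Longrightarrow> E p r \<or> E q s"
    and P6: "E p q \<Longrightarrow> E q r \<Longrightarrow> E r s \<Longrightarrow> E s t \<Longrightarrow> E t u \<Longrightarrow>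
       E p r \<or> E p s \<or> E p t \<or> E p u \<or> E q s \<or> E q t \<or> E q u \<or> E r t \<or> E r u \<or> E s u"
    and K4: "p \<in> V \<Longrightarrow> q \<in> V \<Longrightarrow> r \<in> V \<Longrightarrow> s \<in> V \<Longrightarrow>
       E p q \<or> E p r \<or> E p s \<or> E q r \<or> E q s \<or> E r s"
    and h_in: "h i \<in> V"
    and h_edge: "E (h i) (h (i + 1))"
    and h_chord2: "\<not> E (h i) (h (i + 2))"
    and h_chord3: "\<not> E (h i) (h (i + 3))"
begin

lemma E_commute: "E x y \<longleftrightarrow> E y x"
  using E_sym by blast

lemma hexagon:
  "E (h i) (h (i + 1))" "E (h (i + 1)) (h (i + 2))" "E (h (i + 2)) (h (i + 3))"
  "E (h (i + 3)) (h (i + 4))" "E (h (i + 4)) (h (i + 5))" "E (h (i + 5)) (h i)"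
  "\<not> E (h i) (h (i + 2))" "\<not> E (h (i + 1)) (h (i + 3))" "\<not> E (h (i + 2)) (h (i + 4))"
  "\<not> E (h (i + 3)) (h (i + 5))" "\<not> E (h (i + 4)) (h i)" "\<not> E (h (i + 5)) (h (i + 1))"
  "\<not> E (h i) (h (i + 3))" "\<not> E (h (i + 1)) (h (i + 4))" "\<not> E (h (i + 2)) (h (i + 5))"
  using h_edge[of i] h_edge[of "i + 1"] h_edge[of "i + 2"] h_edge[of "i + 3"]
    h_edge[of "i + 4"] h_edge[of "i + 5"]
    h_chord2[of i] h_chord2[of "i + 1"] h_chord2[of "i + 2"] h_chord2[of "i + 3"]
    h_chord2[of "i + 4"] h_chord2[of "i + 5"]
    h_chord3[of i] h_chord3[of "i + 1"] h_chord3[of "i + 2"]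
  by simp_all

text \<open>\<open>A i\<close> is indexed by the middle one of its three cycle neighbours,
  \<open>B i\<close> by the first of its four. Since \<open>E\<close> is reflexive,
  \<open>h i\<close> itself lies in \<open>A i\<close>, so the classes also cover the cycle.\<close>

definition A :: "6 \<Rightarrow> 'a set" where
  "A i = {x \<in> V. E x (h (i + 5)) \<and> E x (h i) \<and> E x (h (i + 1)) \<and>
     \<not> E x (h (i + 2)) \<and> \<not> E x (h (i + 3)) \<and> \<not> E x (h (i + 4))}"

definition B :: "6 \<Rightarrow> 'a set" where
  "B i = {x \<in> V. E x (h i) \<and> E x (h (i + 1)) \<and> E x (h (i + 2)) \<and> E x (h (i + 3)) \<and>
     \<not> E x (h (i + 4)) \<and> \<not> E x (h (i + 5))}"

definition D :: "6 \<Rightarrow> 'a set" where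
  "D i = {x \<in> V. E x (h i) \<and> E x (h (i + 3)) \<and>
     \<not> E x (h (i + 1)) \<and> \<not> E x (h (i + 2)) \<and> \<not> E x (h (i + 4)) \<and> \<not> E x (h (i + 5))}"

definition F :: "'a set" where
  "F = {x \<in> V. \<forall>i. E x (h i)}"

lemmas class_defs = A_def B_def D_def F_def

lemma D_add_3 [simp]: "D (i + 3) = D i"
  by (auto simp: D_def)

text \<open>The neighbours of \<open>x\<close> on the cycle meet both independent triples (no 4K1),
  include the midpoint of any two of them at distance two (no C4), and are neither a single vertex
  nor just two consecutive ones (no P6).\<close>

lemma classification:
  assumes "x \<in> V"
  shows "\<exists>i. x \<in> A i \<or> x \<in> B i \<or> x \<in> D i \<or> x \<in> F"
proof -
  have triangle: "E x (h i) \<or> E x (h (i + 2)) \<or> E x (h (i + 4))" for i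
    using K4[of x "h i" "h (i + 2)" "h (i + 4)"] assms h_in hexagon[of i] by (auto simp: E_commute)
  have gap: "E x (h (i + 1))" if "E x (h i)" "E x (h (i + 2))" for i
    using C4[of x "h i" "h (i + 1)" "h (i + 2)"] that hexagon[of i] by (auto simp: E_commute)
  have pair: "E x (h (i + 2)) \<or> E x (h (i + 3)) \<or> E x (h (i + 4)) \<or> E x (h (i + 5))"
    if "E x (h (i + 1))" for i
    using P6[of x "h (i + 1)" "h (i + 2)" "h (i + 3)" "h (i + 4)" "h (i + 5)"] that hexagon[of i]
    by (auto simp: E_commute)
  have F: "x \<in> F \<longleftrightarrow> E x (h 0) \<and> E x (h 1) \<and> E x (h 2) \<and> E x (h 3) \<and> E x (h 4) \<and> E x (h 5)"
    using assms six_cases by (auto simp: F_def) metis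
  \<comment> \<open>A propositional check over the six truth values \<open>E x (h j)\<close>: only
    the four kinds of class survive these constraints.\<close>
  have "\<exists>i \<in> {0, 1, 2, 3, 4, 5}. x \<in> A i \<or> x \<in> B i \<or> x \<in> D i \<or> x \<in> F"
    unfolding F
    using assms triangle[of 0] triangle[of 1]
      gap[of 0] gap[of 1] gap[of 2] gap[of 3] gap[of 4] gap[of 5]
      pair[of 0] pair[of 1] pair[of 2] pair[of 3] pair[of 4] pair[of 5]
    by (simp add: A_def B_def D_def six_reduce) argo
  then show ?thesis
    by blast
qed

section \<open>Adjacency between two classes\<close>

text \<open>Typical completeness argument: nonadjacent \<open>x\<close> and \<open>y\<close> with
  two nonadjacent common neighbours, here \<open>h (i + 1)\<close> and \<open>h (i + 5)\<close>,
  would induce a C4.\<close>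

lemma A_A:
  assumes "x \<in> A i" "y \<in> A i"
  shows "E x y"
  using assms hexagon[of i] C4[of "h (i + 1)" x "h (i + 5)" y]
  by (auto simp: class_defs E_commute)

text \<open>The common cycle neighbours \<open>h i\<close> and \<open>h (i + 1)\<close> are
  adjacent, so no C4 arises; instead a non-edge would make the path from \<open>h (i + 3)\<close>
  round to \<open>x\<close>, \<open>h (i + 1)\<close>, \<open>y\<close> an induced P6.\<close>

lemma A_A1:
  assumes "x \<in> A i" "y \<in> A (i + 1)"
  shows "E x y"
  using assms hexagon[of i] P6[of "h (i + 3)" "h (i + 4)" "h (i + 5)" x "h (i + 1)" y]
  by (auto simp: class_defs E_commute)

text \<open>Typical anticompleteness argument: an edge \<open>x y\<close> and a cycle edge between
  private neighbours of \<open>x\<close> and \<open>y\<close> would induce a C4.\<close>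

lemma A_A3:
  assumes "x \<in> A i" "y \<in> A (i + 3)"
  shows "\<not> E x y"
  using assms hexagon[of i] C4[of "h (i + 1)" "h (i + 2)" y x]
  by (auto simp: class_defs E_commute)

lemma B_B:
  assumes "x \<in> B i" "y \<in> B i"
  shows "E x y"
  using assms hexagon[of i] C4[of "h i" x "h (i + 2)" y]
  by (auto simp: class_defs E_commute)

lemma B_B1:
  assumes "x \<in> B i" "y \<in> B (i + 1)"
  shows "E x y"
  using assms hexagon[of i] C4[of "h (i + 1)" x "h (i + 3)" y]
  by (auto simp: class_defs E_commute)

lemma B_B2:
  assumes "x \<in> B i" "y \<in> B (i + 2)"
  shows "\<not> E x y"
  using assms hexagon[of i] C4[of "h i" "h (i + 5)" y x]
  by (auto simp: class_defs E_commute)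

lemma B_B3:
  assumes "x \<in> B i" "y \<in> B (i + 3)"
  shows "E x y"
  using assms hexagon[of i] C4[of "h i" x "h (i + 3)" y]
  by (auto simp: class_defs E_commute)

lemma A1_B:
  assumes "x \<in> A (i + 1)" "y \<in> B i"
  shows "E x y"
  using assms hexagon[of i] C4[of "h i" x "h (i + 2)" y]
  by (auto simp: class_defs E_commute)

lemma A2_B:
  assumes "x \<in> A (i + 2)" "y \<in> B i"
  shows "E x y"
  using assms hexagon[of i] C4[of "h (i + 1)" x "h (i + 3)" y]
  by (auto simp: class_defs E_commute)

lemma A4_B:
  assumes "x \<in> A (i + 4)" "y \<in> B i"
  shows "\<not> E x y"
  using assms hexagon[of i] C4[of "h i" "h (i + 5)" x y]
  by (auto simp: class_defs E_commute)

lemma A5_B: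
  assumes "x \<in> A (i + 5)" "y \<in> B i"
  shows "\<not> E x y"
  using assms hexagon[of i] C4[of "h (i + 3)" "h (i + 4)" x y]
  by (auto simp: class_defs E_commute)

lemma D_D:
  assumes "x \<in> D i" "y \<in> D i"
  shows "E x y"
  using assms hexagon[of i] C4[of "h i" x "h (i + 3)" y]
  by (auto simp: class_defs E_commute)

text \<open>The only common cycle neighbour is \<open>h i\<close>, so the long way round through
  \<open>y\<close> and \<open>x\<close> is used, as an induced P6.\<close>

lemma D_A:
  assumes "x \<in> D i" "y \<in> A i"
  shows "E x y"
  using assms hexagon[of i] P6[of "h (i + 1)" y "h (i + 5)" "h (i + 4)" "h (i + 3)" x]
  by (auto simp: class_defs E_commute)

lemma D_A1:
  assumes "x \<in> D i" "y \<in> A (i + 1)"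
  shows "\<not> E x y"
  using assms hexagon[of i] C4[of "h (i + 2)" "h (i + 3)" x y]
  by (auto simp: class_defs E_commute)

lemma D_A2:
  assumes "x \<in> D i" "y \<in> A (i + 2)"
  shows "\<not> E x y"
  using assms hexagon[of i] C4[of "h i" "h (i + 1)" y x]
  by (auto simp: class_defs E_commute)

lemma D_B:
  assumes "x \<in> D i" "y \<in> B i"
  shows "E x y"
  using assms hexagon[of i] C4[of "h i" x "h (i + 3)" y]
  by (auto simp: class_defs E_commute)

lemma D_B1:
  assumes "x \<in> D i" "y \<in> B (i + 1)"
  shows "\<not> E x y"
  using assms hexagon[of i] C4[of "h i" "h (i + 1)" y x]
  by (auto simp: class_defs E_commute)

lemma D_B2:
  assumes "x \<in> D i" "y \<in> B (i + 2)"
  shows "\<not> E x y"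
  using assms hexagon[of i] C4[of "h i" "h (i + 5)" y x]
  by (auto simp: class_defs E_commute)

lemma D_D1:
  assumes "x \<in> D i" "y \<in> D (i + 1)"
  shows "\<not> E x y"
  using assms hexagon[of i] C4[of "h i" "h (i + 1)" y x]
  by (auto simp: class_defs E_commute)

lemma F_F:
  assumes "x \<in> F" "y \<in> F"
  shows "E x y"
  using assms hexagon[of i] C4[of "h i" x "h (i + 2)" y]
  by (auto simp: class_defs E_commute)

lemma F_A:
  assumes "x \<in> F" "y \<in> A i"
  shows "E x y"
  using assms hexagon[of i] C4[of "h (i + 1)" x "h (i + 5)" y]
  by (auto simp: class_defs E_commute)

lemma F_B:
  assumes "x \<in> F" "y \<in> B i"
  shows "E x y"
  using assms hexagon[of i] C4[of "h i" x "h (i + 2)" y]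
  by (auto simp: class_defs E_commute)

lemma F_D:
  assumes "x \<in> F" "y \<in> D i"
  shows "E x y"
  using assms hexagon[of i] C4[of "h i" x "h (i + 3)" y]
  by (auto simp: class_defs E_commute)

section \<open>Adjacency among three classes\<close>

text \<open>The vertex \<open>h (i + 5)\<close> sees \<open>x\<close> and \<open>z\<close> but not
  \<open>y\<close>, and closes the path \<open>x\<close>, \<open>y\<close>, \<open>z\<close> to a
  4-cycle.\<close>

lemma A_A2_A4_trans:
  assumes "x \<in> A i" "y \<in> A (i + 2)" "z \<in> A (i + 4)" "E x y" "E y z"
  shows "E x z"
  using assms hexagon[of i] C4[of "h (i + 5)" x y z]
  by (auto simp: class_defs E_commute)

text \<open>If \<open>y\<close> and \<open>z\<close> were nonadjacent, 4-cycles through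
  \<open>h (i + 3)\<close> would exclude the edges \<open>x z\<close> and \<open>u y\<close>, and
  \<open>h (i + 2)\<close>, \<open>y\<close>, \<open>x\<close>, \<open>u\<close>, \<open>z\<close>,
  \<open>h (i + 4)\<close> would induce a P6.\<close>

lemma A_A2_A4_link:
  assumes "x \<in> A i" "y \<in> A (i + 2)" "u \<in> A i" "z \<in> A (i + 4)" "E x y" "E u z"
  shows "E y z"
  using assms hexagon[of i] C4[of "h (i + 1)" x "h (i + 5)" u] C4[of "h i" x y u] C4[of "h i" x z u] P6[of "h (i + 2)" y x u z "h (i + 4)"] C4[of "h (i + 3)" y u z] C4[of "h (i + 3)" y x z]
  by (auto simp: class_defs E_commute)

lemma A_A2_B:
  assumes "x \<in> A i" "y \<in> A (i + 2)" "z \<in> B i" "E x y"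
  shows "E x z"
  using assms hexagon[of i] C4[of "h (i + 1)" y "h (i + 3)" z] C4[of "h i" x y z]
  by (auto simp: class_defs E_commute)

lemma A_A4_B3:
  assumes "x \<in> A i" "y \<in> A (i + 4)" "z \<in> B (i + 3)" "E x y"
  shows "E x z"
  using assms hexagon[of i] C4[of "h (i + 3)" y "h (i + 5)" z] C4[of "h i" x y z]
  by (auto simp: class_defs E_commute)

text \<open>4-cycles exclude first the edge \<open>y z\<close>, then \<open>x z\<close>; what
  remains is the induced P6 \<open>h (i + 2)\<close>, \<open>y\<close>, \<open>x\<close>,
  \<open>h i\<close>, \<open>z\<close>, \<open>h (i + 4)\<close>.\<close>

lemma A_A2_B3:
  assumes "x \<in> A i" "y \<in> A (i + 2)" "z \<in> B (i + 3)" "E x y"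
  shows "False"
  using assms hexagon[of i] P6[of "h (i + 2)" y x "h i" z "h (i + 4)"] C4[of "h i" "h (i + 1)" y z] C4[of "h (i + 3)" y x z]
  by (auto simp: class_defs E_commute)

lemma A_A4_B:
  assumes "x \<in> A i" "y \<in> A (i + 4)" "z \<in> B i" "E x y"
  shows "False"
  using assms hexagon[of i] P6[of "h (i + 2)" z "h i" x y "h (i + 4)"] C4[of "h i" "h (i + 5)" y z] C4[of "h (i + 3)" y x z]
  by (auto simp: class_defs E_commute)

text \<open>This makes the later cut of \<open>B i\<close> work: missing a vertex of
  \<open>A i\<close> forces completeness to \<open>A (i + 3)\<close>.\<close>

lemma A_A3_B:
  assumes "x \<in> A i" "y \<in> A (i + 3)" "z \<in> B i"
  shows "E x z \<or> E y z"
  using assms hexagon[of i] P6[of "h (i + 4)" y "h (i + 2)" z "h i" x] C4[of "h (i + 1)" "h (i + 2)" y x]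
  by (auto simp: class_defs E_commute)

section \<open>A partition into 26 sets\<close>

lemma classes_subset: "A i \<subseteq> V" "B i \<subseteq> V" "D i \<subseteq> V" "F \<subseteq> V"
  by (auto simp: class_defs)

lemma A_disjoint:
  assumes "x \<in> A i" "x \<in> A j"
  shows "i = j"
  using assms by (cases rule: six_offset_cases[of j i]) (auto simp: A_def)

lemma A_B_disjoint:
  assumes "x \<in> A i" "x \<in> B j"
  shows False
  using assms by (cases rule: six_offset_cases[of i j]) (auto simp: A_def B_def)

lemma B_disjoint:
  assumes "x \<in> B i" "x \<in> B j"
  shows "i = j"
  using assms by (cases rule: six_offset_cases[of j i]) (auto simp: B_def)

text \<open>
  The only pairs of classes that can be neither complete nor anticomplete are \<open>A i\<close>, \<open>A (i + 2)\<close>,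
  and \<open>A i\<close> with \<open>B i\<close> or \<open>B (i + 3)\<close>. The classes are cut so that these pairs no longer
  interact: a linked vertex of \<open>A i\<close> is complete to \<open>B i\<close> and \<open>B (i + 3)\<close>, and a vertex of \<open>B i\<close>
  with a non-neighbour in \<open>A i\<close> is complete to \<open>A (i + 3)\<close>.
\<close>

definition A_link :: "6 \<Rightarrow> 'a set" where
  "A_link i = {x \<in> A i. \<exists>y \<in> A (i + 2) \<union> A (i + 4). E x y}"

definition A_free :: "6 \<Rightarrow> 'a set" where
  "A_free i = A i - A_link i"

definition B_part :: "6 \<Rightarrow> 'a set" where
  "B_part i = {y \<in> B i. \<exists>x \<in> A i. \<not> E x y}"

definition B_full :: "6 \<Rightarrow> 'a set" where
  "B_full i = B i - B_part i"

lemmas split_defs = A_link_def A_free_def B_part_def B_full_def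

text \<open>A link into \<open>A (i + 2)\<close> gives completeness to \<open>B i\<close> and leaves
  \<open>B (i + 3)\<close> empty; a link into \<open>A (i + 4)\<close> does the same with the two
  exchanged.\<close>

lemma A_link_B:
  assumes "x \<in> A_link i" "y \<in> B i \<union> B (i + 3)"
  shows "E x y"
  using assms A_A2_B[of x i _ y] A_A4_B[of x i _ y] A_A2_B3[of x i _ y] A_A4_B3[of x i _ y]
  by (auto simp: A_link_def)

lemma A_B_full: "x \<in> A i \<Longrightarrow> y \<in> B_full i \<Longrightarrow> E x y"
  by (auto simp: split_defs)

lemma A_B_part:
  assumes "x \<in> A i" "y \<in> B_part (i + 3)"
  shows "E x y"
  using assms A_A3_B[of _ "i + 3" x y] by (auto simp: split_defs)

lemma A_free_A2:
  assumes "x \<in> A_free i" "y \<in> A (i + 2) \<union> A (i + 4)"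
  shows "\<not> E x y"
  using assms by (auto simp: split_defs)

text \<open>Keeps chains apart: an incomplete pair of link classes leaves nothing in the third class
  of its triple, so no second incomplete pair can share a class with it.\<close>

lemma A_link_incomplete:
  assumes x: "x \<in> A_link i" and y: "y \<in> A_link (i + 2)" and xy: "\<not> E x y"
  shows "A_link (i + 4) = {}"
proof (rule ccontr)
  assume "A_link (i + 4) \<noteq> {}"
  then obtain z where z: "z \<in> A_link (i + 4)"
    by blast
  have in_A: "x \<in> A i" "y \<in> A (i + 2)" "z \<in> A (i + 4)"
    using x y z by (auto simp: A_link_def)
  define touches where "touches k v \<longleftrightarrow> (\<exists>w \<in> A k. E v w)" for k v
  \<comment> \<open>Vertices of two of the classes that both have a neighbour in the third are
    adjacent.\<close>
  have link: "E u v" if "u \<in> A (k + 2)" "v \<in> A (k + 4)" "touches k u" "touches k v" for k u v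
    using that A_A2_A4_link[of _ k u _ v] by (auto simp: touches_def E_commute)
  have touch: "touches k u" if "E u v" "v \<in> A k" for u v k
    using that by (auto simp: touches_def)
  have not_both: "\<not> (E x z \<and> E y z)"
    using A_A2_A4_trans[of y "i + 2" z x] in_A xy by (auto simp: E_commute)
  have yx: "\<not> (touches (i + 4) x \<and> touches (i + 4) y)"
    using link[of x "i + 4" y] in_A xy by auto
  have zx: "E x z" if "touches (i + 2) x" "touches (i + 2) z"
    using link[of z "i + 2" x] in_A that by (auto simp: E_commute)
  have yz: "E y z" if "touches i y" "touches i z"
    using link[of y i z] in_A that by auto
  \<comment> \<open>The neighbour \<open>w\<close> of \<open>z\<close> and the vertex
    \<open>y\<close> both touch \<open>A (i + 4)\<close>, hence are adjacent.\<close>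
  have y_spread: "touches i y" if z_touch: "touches i z" and "touches (i + 4) y"
  proof -
    obtain w where w: "w \<in> A i" "E z w"
      using z_touch by (auto simp: touches_def)
    then have "E w y"
      using link[of w "i + 4" y] touch[of w z "i + 4"] in_A that by (auto simp: E_commute)
    then show ?thesis
      using w touch[of y w i] by (simp add: E_commute)
  qed
  have x_spread: "touches (i + 2) x" if z_touch: "touches (i + 2) z" and "touches (i + 4) x"
  proof -
    obtain w where w: "w \<in> A (i + 2)" "E z w"
      using z_touch by (auto simp: touches_def)
    then have "E x w"
      using link[of x "i + 4" w] touch[of w z "i + 4"] in_A that by (auto simp: E_commute)
    then show ?thesis
      using w touch by blast
  qed
  \<comment> \<open>If \<open>x\<close> does not touch \<open>A (i + 4)\<close>, it touches
    \<open>A (i + 2)\<close>; then \<open>z\<close> touches only \<open>A i\<close>, so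
    \<open>y\<close> touches only \<open>A (i + 4)\<close>, against \<open>y_spread\<close>.
    Otherwise \<open>y\<close> does not touch \<open>A (i + 4)\<close>, and \<open>x_spread\<close>
    is violated likewise.\<close>
  have "touches (i + 2) x \<or> touches (i + 4) x" "touches (i + 4) y \<or> touches i y"
    "touches i z \<or> touches (i + 2) z"
    using x y z by (auto simp: A_link_def touches_def)
  moreover have "E x z \<Longrightarrow> touches (i + 4) x \<and> touches i z"
    "E y z \<Longrightarrow> touches (i + 4) y \<and> touches (i + 2) z"
    using touch in_A E_sym by blast+
  ultimately show False
    using not_both yx zx yz y_spread x_spread by blast
qed

lemma split_subset: "A_link i \<subseteq> A i" "A_free i \<subseteq> A i" "B_part i \<subseteq> B i" "B_full i \<subseteq> B i"
  by (auto simp: split_defs)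

lemma B_part_full_disjoint: "z \<in> B_part i \<Longrightarrow> z \<in> B_full j \<Longrightarrow> False"
  using B_disjoint[of z i j] by (auto simp: B_full_def B_part_def)

section \<open>Pairs of sets that form chain graphs\<close>

text \<open>These pairs carry the chains. Two halves from \<open>B i\<close> and
  \<open>B (i + 3)\<close> share one chain, so that \<open>A_free i\<close> occurs in a single pair;
  link pairs enter only when incomplete, since otherwise neighbouring pairs would overlap.\<close>

definition live :: "('a set \<times> 'a set) set" where
  "live = range (\<lambda>i. (A_free i, B_part i \<union> B_full (i + 3))) \<union>
     {(A_link i, A_link (i + 2)) | i. \<not> (\<forall>x \<in> A_link i. \<forall>y \<in> A_link (i + 2). E x y)}"

text \<open>Two distinct pairs with a common class would put a vertex into a class already emptied
  by \<open>A_link_incomplete\<close>.\<close>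

lemma A_link_pairs_disjoint:
  assumes i: "x \<in> A_link i" "y \<in> A_link (i + 2)" "\<not> E x y"
    and j: "x' \<in> A_link j" "y' \<in> A_link (j + 2)" "\<not> E x' y'"
    and "z \<in> A_link i \<union> A_link (i + 2)" "z \<in> A_link j \<union> A_link (j + 2)"
  shows "i = j"
proof -
  have empty: "A_link (i + 4) = {}" "A_link (j + 4) = {}"
    using A_link_incomplete i j by blast+
  have "i = j \<or> i = j + 2 \<or> i + 2 = j \<or> i + 2 = j + 2"
    using assms(7,8) A_disjoint[of z] unfolding A_link_def by blast
  then show ?thesis
    using empty i(2) j(2) by auto
qed

lemma free_live: "(A_free i, B_part i \<union> B_full (i + 3)) \<in> live"
  unfolding live_def by blast

lemma live_cases:
  assumes "(X, Y) \<in> live"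
  obtains (free) i where "X = A_free i" "Y = B_part i \<union> B_full (i + 3)"
  | (link) i x y where "X = A_link i" "Y = A_link (i + 2)" "x \<in> X" "y \<in> Y" "\<not> E x y"
  using assms unfolding live_def by blast

text \<open>Cliques on both sides turn C4-freeness into the chain condition. For the union of two
  halves this rests on \<open>B_B3\<close>.\<close>

lemma live_cliques:
  assumes "(X, Y) \<in> live"
  shows "X \<subseteq> V" "Y \<subseteq> V" "x \<in> X \<Longrightarrow> x' \<in> X \<Longrightarrow> E x x'" "y \<in> Y \<Longrightarrow> y' \<in> Y \<Longrightarrow> E y y'"
proof -
  have "X \<subseteq> V \<and> Y \<subseteq> V \<and> (x \<in> X \<longrightarrow> x' \<in> X \<longrightarrow> E x x') \<and> (y \<in> Y \<longrightarrow> y' \<in> Y \<longrightarrow> E y y')"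
    using assms
  proof (cases rule: live_cases)
    case (free i)
    then have "X \<subseteq> A i" "Y \<subseteq> B i \<union> B (i + 3)"
      by (auto simp: split_defs)
    then show ?thesis
      using classes_subset(1)[of i] classes_subset(2)[of i] classes_subset(2)[of "i + 3"]
        A_A[of x i x'] B_B[of y i y'] B_B[of y "i + 3" y'] B_B3[of y i y'] B_B3[of y' i y]
        E_sym[of y' y]
      by blast
  next
    case (link i)
    then have "X \<subseteq> A i" "Y \<subseteq> A (i + 2)"
      by (auto simp: A_link_def)
    then show ?thesis
      using classes_subset(1)[of i] classes_subset(1)[of "i + 2"] A_A[of x i x'] A_A[of y "i + 2" y']
      by blast
  qed
  then show "X \<subseteq> V" "Y \<subseteq> V" "x \<in> X \<Longrightarrow> x' \<in> X \<Longrightarrow> E x x'" "y \<in> Y \<Longrightarrow> y' \<in> Y \<Longrightarrow> E y y'"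
    by blast+
qed

text \<open>Allows the rankings of the separate chains to be glued. A vertex shared by two free
  pairs lies in halves of the same kind, because \<open>B_part\<close> and \<open>B_full\<close>
  never meet, and this fixes the index.\<close>

lemma live_disjoint:
  assumes XY: "(X, Y) \<in> live" and XY': "(X', Y') \<in> live"
    and z: "z \<in> X \<union> Y" "z \<in> X' \<union> Y'"
  shows "(X, Y) = (X', Y')"
proof -
  have free_free: "i = j" if "z \<in> A_free i \<union> (B_part i \<union> B_full (i + 3))"
    "z \<in> A_free j \<union> (B_part j \<union> B_full (j + 3))" for i j
  proof -
    have "z \<in> A i \<and> z \<in> A j \<or> z \<in> B_part i \<and> z \<in> B_part j \<or> z \<in> B_full (i + 3) \<and> z \<in> B_full (j + 3)
      \<or> z \<in> B_part i \<and> z \<in> B_full (j + 3) \<or> z \<in> B_part j \<and> z \<in> B_full (i + 3)"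
      using that A_B_disjoint[of z] unfolding split_defs by blast
    then consider "z \<in> A i" "z \<in> A j" | "z \<in> B i" "z \<in> B j"
      | "z \<in> B (i + 3)" "z \<in> B (j + 3)"
      using B_part_full_disjoint split_subset by blast
    then show ?thesis
      using A_disjoint B_disjoint[of z i j] B_disjoint[of z "i + 3" "j + 3"] by cases simp_all
  qed
  have free_link: False if "z \<in> A_free i \<union> (B_part i \<union> B_full (i + 3))"
    "z \<in> A_link j" for i j
    using that A_disjoint[of z i j] A_B_disjoint[of z j] by (auto simp: split_defs)
  show ?thesis
    using XY
  proof (cases rule: live_cases)
    case (free i)
    note i = this
    from XY' show ?thesis
    proof (cases rule: live_cases)
      case (free j)
      then show ?thesis
        using i z free_free[of i j] by simp
    next
      case (link j)
      then show ?thesis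
        using i z free_link by blast
    qed
  next
    case (link i x y)
    note i = this
    from XY' show ?thesis
    proof (cases rule: live_cases)
      case (free j)
      then show ?thesis
        using i z free_link by blast
    next
      case (link j x' y')
      have "i = j"
        by (rule A_link_pairs_disjoint[of x i y x' j y' z]) (use i link z in simp_all)
      then show ?thesis
        using i link by simp
    qed
  qed
qed

lemma live_disjoint_self:
  assumes "(X, Y) \<in> live"
  shows "X \<inter> Y = {}"
  using assms
proof (cases rule: live_cases)
  case (free i)
  then show ?thesis
    using A_B_disjoint by (auto simp: split_defs)
next
  case (link i)
  then show ?thesis
    using A_disjoint[of _ i "i + 2"] by (auto simp: A_link_def)
qed

definition homogeneous :: "'a set \<Rightarrow> 'a set \<Rightarrow> bool" where
  "homogeneous X Y \<longleftrightarrow> (\<forall>x \<in> X. \<forall>y \<in> Y. E x y) \<or> (\<forall>x \<in> X. \<forall>y \<in> Y. \<not> E x y)"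

lemma homogeneous_commute: "homogeneous X Y \<longleftrightarrow> homogeneous Y X"
  unfolding homogeneous_def using E_commute by blast

definition D_all :: "'a set" where
  "D_all = (\<Union>i. D i)"

text \<open>\<open>x\<close>, \<open>y\<close> and the antipodal vertices \<open>h (i + 2)\<close>,
  \<open>h (i + 5)\<close> would induce a 4K1.\<close>

lemma D_D1_empty:
  assumes "x \<in> D i" "y \<in> D (i + 1)"
  shows False
  using assms K4[of x y "h (i + 2)" "h (i + 5)"] D_D1[OF assms] h_in hexagon[of i]
  by (auto simp: D_def)

text \<open>As \<open>D i\<close> depends on \<open>i\<close> modulo three only, distinct classes
  have consecutive indices up to order, and one nonempty class empties the others.\<close>

lemma D_all_eq: "\<exists>i. D_all = D i"
proof (cases "D_all = {}")
  case True
  then show ?thesis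
    by (auto simp: D_all_def)
next
  case False
  then obtain x i where x: "x \<in> D i"
    by (auto simp: D_all_def)
  have "D j \<subseteq> D i" for j
    using x D_D1_empty[of x i] D_D1_empty[of _ "i + 2" x] D_add_3[of i] D_add_3[of "i + 1"] D_add_3[of "i + 2"]
    by (cases rule: six_offset_cases[of j i]) auto
  then have "D_all = D i"
    unfolding D_all_def by blast
  then show ?thesis ..
qed

lemma homogeneous_D_A: "homogeneous (D i) (A j)"
  using D_A[of _ i] D_A[of _ "i + 3"] D_A1[of _ i] D_A1[of _ "i + 3"] D_A2[of _ i] D_A2[of _ "i + 3"]
  by (cases rule: six_offset_cases[of j i]) (auto simp: homogeneous_def)

lemma homogeneous_D_B: "homogeneous (D i) (B j)"
  using D_B[of _ i] D_B[of _ "i + 3"] D_B1[of _ i] D_B1[of _ "i + 3"] D_B2[of _ i] D_B2[of _ "i + 3"]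
  by (cases rule: six_offset_cases[of j i]) (auto simp: homogeneous_def)

lemma homogeneous_B_B: "homogeneous (B i) (B j)"
proof -
  have *: "homogeneous (B i) (B i)" "homogeneous (B i) (B (i + 1))" "homogeneous (B i) (B (i + 2))"
    "homogeneous (B i) (B (i + 3))" for i
    using B_B[of _ i] B_B1[of _ i] B_B2[of _ i] B_B3[of _ i] unfolding homogeneous_def by blast+
  show ?thesis
    \<comment> \<open>Offsets five and four are offsets one and two seen from the other
      class.\<close>
    using *[of i] *(2)[of "i + 5"] *(3)[of "i + 4"]
    by (cases rule: six_offset_cases[of j i]) (simp_all add: homogeneous_commute)
qed

lemma F_complete:
  assumes "x \<in> F" "y \<in> V"
  shows "E x y"
proof -
  obtain i where "y \<in> A i \<or> y \<in> B i \<or> y \<in> D i \<or> y \<in> F"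
    using classification[OF assms(2)] ..
  then show ?thesis
    using assms(1) F_A[of x y i] F_B[of x y i] F_D[of x y i] F_F[of x y] by blast
qed

lemma homogeneous_A_B:
  assumes "j \<noteq> i" "j \<noteq> i + 3"
  shows "homogeneous (A i) (B j)"
  using assms A1_B[of _ j] A2_B[of _ j] A4_B[of _ j] A5_B[of _ j]
  by (cases rule: six_offset_cases[of i j]) (auto simp: homogeneous_def)

lemma homogeneous_A_A:
  assumes "j \<noteq> i + 2" "j \<noteq> i + 4"
  shows "homogeneous (A i) (A j)"
proof -
  have *: "homogeneous (A i) (A i)" "homogeneous (A i) (A (i + 1))" "homogeneous (A i) (A (i + 3))" for i
    using A_A[of _ i] A_A1[of _ i] A_A3[of _ i] unfolding homogeneous_def by blast+
  show ?thesis
    using assms *[of i] *(2)[of "i + 5"]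
    by (cases rule: six_offset_cases[of j i]) (simp_all add: homogeneous_commute)
qed

lemma homogeneous_subset: "homogeneous X Y \<Longrightarrow> X' \<subseteq> X \<Longrightarrow> Y' \<subseteq> Y \<Longrightarrow> homogeneous X' Y'"
  unfolding homogeneous_def by blast

section \<open>Every two parts are homogeneous or lie in a chain\<close>

text \<open>Inclusion in \<open>Z\<close> rather than equality, because the second member of a live
  pair may consist of two parts.\<close>

definition tame :: "'a set \<Rightarrow> 'a set \<Rightarrow> bool" where
  "tame X Y \<longleftrightarrow> homogeneous X Y \<or>
     (\<exists>Z. (X, Z) \<in> live \<and> Y \<subseteq> Z) \<or> (\<exists>Z. (Y, Z) \<in> live \<and> X \<subseteq> Z)"

lemma tame_homogeneous: "homogeneous X' Y' \<Longrightarrow> X \<subseteq> X' \<Longrightarrow> Y \<subseteq> Y' \<Longrightarrow> tame X Y"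
  using homogeneous_subset unfolding tame_def by blast

lemma tame_complete: "(\<And>x y. x \<in> X \<Longrightarrow> y \<in> Y \<Longrightarrow> E x y) \<Longrightarrow> tame X Y"
  unfolding tame_def homogeneous_def by blast

lemma tame_anticomplete: "(\<And>x y. x \<in> X \<Longrightarrow> y \<in> Y \<Longrightarrow> \<not> E x y) \<Longrightarrow> tame X Y"
  unfolding tame_def homogeneous_def by blast

lemma tame_live: "(X, Z) \<in> live \<Longrightarrow> Y \<subseteq> Z \<Longrightarrow> tame X Y"
  unfolding tame_def by blast

lemma tame_commute: "tame X Y \<longleftrightarrow> tame Y X"
  unfolding tame_def using homogeneous_commute by blast

lemma tame_link_link: "tame (A_link i) (A_link j)"
proof -
  \<comment> \<open>A link pair outside \<open>live\<close> is complete, by the definition of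
    \<open>live\<close>.\<close>
  have *: "tame (A_link i) (A_link (i + 2))" for i
    unfolding tame_def live_def homogeneous_def by blast
  consider "j \<noteq> i + 2" "j \<noteq> i + 4" | "j = i + 2" | "j = i + 4"
    by blast
  then show ?thesis
  proof cases
    case 1
    then show ?thesis
      using tame_homogeneous[OF homogeneous_A_A split_subset(1) split_subset(1)] by blast
  next
    case 2
    then show ?thesis
      using * by simp
  next
    case 3
    then show ?thesis
      using *[of j] tame_commute by simp
  qed
qed

lemma tame_free_A:
  assumes "X \<subseteq> A j"
  shows "tame (A_free i) X"
proof (cases "j = i + 2 \<or> j = i + 4")
  case True
  then show ?thesis
    using assms by (intro tame_anticomplete A_free_A2[of _ i]) auto
next
  case False
  then show ?thesis
    using tame_homogeneous[OF homogeneous_A_A split_subset(2) assms] by blast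
qed

lemma tame_link_B:
  assumes "Y \<subseteq> B j"
  shows "tame (A_link i) Y"
proof (cases "j = i \<or> j = i + 3")
  case True
  then show ?thesis
    using assms by (intro tame_complete A_link_B[of _ i]) auto
next
  case False
  then show ?thesis
    using tame_homogeneous[OF homogeneous_A_B split_subset(1) assms] by blast
qed

lemma tame_free_part: "tame (A_free i) (B_part j)"
proof -
  consider "j = i" | "j = i + 3" | "j \<noteq> i" "j \<noteq> i + 3"
    by blast
  then show ?thesis
  proof cases
    case 1
    then show ?thesis
      using tame_live[OF free_live[of i]] by simp
  next
    case 2
    then show ?thesis
      using split_subset(2) by (intro tame_complete A_B_part[of _ i]) auto
  next
    case 3
    then show ?thesis
      using tame_homogeneous[OF homogeneous_A_B split_subset(2) split_subset(3)] by blast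
  qed
qed

lemma tame_free_full: "tame (A_free i) (B_full j)"
proof -
  consider "j = i" | "j = i + 3" | "j \<noteq> i" "j \<noteq> i + 3"
    by blast
  then show ?thesis
  proof cases
    case 1
    then show ?thesis
      using split_subset(2) by (intro tame_complete A_B_full[of _ i]) auto
  next
    case 2
    then show ?thesis
      using tame_live[OF free_live[of i]] by simp
  next
    case 3
    then show ?thesis
      using tame_homogeneous[OF homogeneous_A_B split_subset(2) split_subset(4)] by blast
  qed
qed

lemma tame_B_B: "X \<subseteq> B i \<Longrightarrow> Y \<subseteq> B j \<Longrightarrow> tame X Y"
  by (rule tame_homogeneous[OF homogeneous_B_B])

lemma tame_D:
  assumes "Y \<subseteq> A j \<or> Y \<subseteq> B j \<or> Y = D_all"
  shows "tame D_all Y"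
proof -
  obtain i where "D_all = D i"
    using D_all_eq by blast
  moreover have "homogeneous (D i) (D i)"
    using D_D unfolding homogeneous_def by blast
  ultimately show ?thesis
    using assms tame_homogeneous[OF homogeneous_D_A[of i j]] tame_homogeneous[OF homogeneous_D_B[of i j]]
      tame_homogeneous[of "D i" "D i"] by auto
qed

lemma tame_F: "Y \<subseteq> V \<Longrightarrow> tame F Y"
  using F_complete by (intro tame_complete) auto

definition parts :: "'a set set" where
  "parts = range A_link \<union> range A_free \<union> range B_part \<union> range B_full \<union> {D_all, F}"

text \<open>Four families of six and two single sets; only a bound, since empty parts may
  coincide.\<close>

lemma card_parts: "finite parts" "card parts \<le> 26"
proof -
  have range6: "card (range f) \<le> 6" for f :: "6 \<Rightarrow> 'a set"
    using card_image_le[of UNIV f] by simp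
  show "finite parts"
    by (simp add: parts_def)
  have "card (range A_link \<union> range A_free \<union> range B_part \<union> range B_full \<union> {D_all, F})
      \<le> 6 + 6 + 6 + 6 + 2"
    by (intro order.trans[OF card_Un_le] add_mono range6) (simp add: card_insert_if)
  then show "card parts \<le> 26"
    by (simp add: parts_def)
qed

lemma Union_parts: "\<Union> parts = V"
proof
  show "\<Union> parts \<subseteq> V"
    by (auto simp: parts_def D_all_def split_defs class_defs)
  show "V \<subseteq> \<Union> parts"
  proof
    fix x
    assume "x \<in> V"
    then obtain i where "x \<in> A i \<or> x \<in> B i \<or> x \<in> D i \<or> x \<in> F"
      using classification by blast
    then have "x \<in> A_link i \<union> A_free i \<union> B_part i \<union> B_full i \<union> D_all \<union> F"
      by (auto simp: A_free_def B_full_def D_all_def)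
    then show "x \<in> \<Union> parts"
      by (auto simp: parts_def)
  qed
qed

lemma tame_parts:
  assumes "X \<in> parts" "Y \<in> parts"
  shows "tame X Y"
proof -
  have "X \<subseteq> V" "Y \<subseteq> V"
    using assms Union_parts by blast+
  consider i where "X = A_link i" | i where "X = A_free i" | i where "X = B_part i"
    | i where "X = B_full i" | "X = D_all" | "X = F"
    using assms(1) unfolding parts_def by blast
  note X = this
  consider i where "Y = A_link i" | i where "Y = A_free i" | i where "Y = B_part i"
    | i where "Y = B_full i" | "Y = D_all" | "Y = F"
    using assms(2) unfolding parts_def by blast
  note Y = this
  note rules = tame_link_link tame_free_A[OF split_subset(1)] tame_free_A[OF split_subset(2)]
    tame_link_B[OF split_subset(3)] tame_link_B[OF split_subset(4)] tame_free_part tame_free_full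
    tame_B_B[OF split_subset(3) split_subset(3)] tame_B_B[OF split_subset(3) split_subset(4)]
    tame_B_B[OF split_subset(4) split_subset(4)]
    tame_D[OF disjI1[OF split_subset(1)]] tame_D[OF disjI1[OF split_subset(2)]]
    tame_D[OF disjI2[OF disjI1[OF split_subset(3)]]] tame_D[OF disjI2[OF disjI1[OF split_subset(4)]]]
    tame_D[OF disjI2[OF disjI2[OF refl]]] tame_F[OF \<open>X \<subseteq> V\<close>] tame_F[OF \<open>Y \<subseteq> V\<close>]
  show ?thesis
    by (cases rule: X; cases rule: Y) (use rules rules[THEN tame_commute[THEN iffD1]] in simp_all)
qed

section \<open>One ranking for all chains\<close>

lemma rank_exists:
  obtains r :: "'a \<Rightarrow> nat" where
    "\<And>X Y x y. (X, Y) \<in> live \<Longrightarrow> x \<in> X \<Longrightarrow> y \<in> Y \<Longrightarrow> (E x y \<longleftrightarrow> r x < r y) \<and> r x \<noteq> r y"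
proof -
  have "\<exists>k :: 'a \<Rightarrow> nat. \<forall>x \<in> X. \<forall>y \<in> Y. (E x y \<longleftrightarrow> k x < k y) \<and> k x \<noteq> k y"
    if L: "(X, Y) \<in> live" for X Y
  proof -
    \<comment> \<open>The edges \<open>x y\<close> and \<open>x' y'\<close> and the two cliques
      close the 4-cycle \<open>x\<close>, \<open>y\<close>, \<open>y'\<close>, \<open>x'\<close>;
      its chord is the required edge.\<close>
    have chain: "E x y' \<or> E x' y" if "x \<in> X" "x' \<in> X" "y \<in> Y" "y' \<in> Y" "E x y" "E x' y'" for x x' y y'
      using C4[of x y y' x'] live_cliques(3,4)[OF L] that E_sym by blast
    obtain p q :: "'a \<Rightarrow> nat" where
      pq: "\<And>x y. x \<in> X \<Longrightarrow> y \<in> Y \<Longrightarrow> (E x y \<longleftrightarrow> p x < q y) \<and> p x \<noteq> q y"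
      by (rule chain_rank[of X Y E])
        (use chain finite_subset[OF live_cliques(1)[OF L] fin] in auto)
    have "x \<notin> Y" if "x \<in> X" for x
      using live_disjoint_self[OF L] that by blast
    then show ?thesis
      using pq by (intro exI[of _ "\<lambda>v. if v \<in> Y then q v else p v"]) auto
  qed
  then have "\<forall>P \<in> live. \<exists>k :: 'a \<Rightarrow> nat.
      \<forall>x \<in> fst P. \<forall>y \<in> snd P. (E x y \<longleftrightarrow> k x < k y) \<and> k x \<noteq> k y"
    by auto
  from bchoice[OF this] obtain k :: "'a set \<times> 'a set \<Rightarrow> 'a \<Rightarrow> nat" where
    "\<forall>P \<in> live. \<forall>x \<in> fst P. \<forall>y \<in> snd P. (E x y \<longleftrightarrow> k P x < k P y) \<and> k P x \<noteq> k P y" ..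
  then have k: "(E x y \<longleftrightarrow> k (X, Y) x < k (X, Y) y) \<and> k (X, Y) x \<noteq> k (X, Y) y"
    if "(X, Y) \<in> live" "x \<in> X" "y \<in> Y" for X Y x y
    using that by fastforce
  \<comment> \<open>By \<open>live_disjoint\<close> at most one live pair contains \<open>v\<close>;
    outside all live pairs the value of \<open>r\<close> is arbitrary.\<close>
  define r where "r v = k (THE P. P \<in> live \<and> v \<in> fst P \<union> snd P) v" for v
  have r: "r v = k (X, Y) v" if "(X, Y) \<in> live" "v \<in> X \<union> Y" for X Y v
  proof -
    have "(THE P. P \<in> live \<and> v \<in> fst P \<union> snd P) = (X, Y)"
    proof (rule the_equality)
      show "(X, Y) \<in> live \<and> v \<in> fst (X, Y) \<union> snd (X, Y)"
        using that by simp
      show "P = (X, Y)" if "P \<in> live \<and> v \<in> fst P \<union> snd P" for P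
        using live_disjoint[of "fst P" "snd P" X Y v] that \<open>(X, Y) \<in> live\<close> \<open>v \<in> X \<union> Y\<close> by simp
    qed
    then show ?thesis
      by (simp add: r_def)
  qed
  show thesis
  proof (rule that[of r])
    show "(E x y \<longleftrightarrow> r x < r y) \<and> r x \<noteq> r y" if "(X, Y) \<in> live" "x \<in> X" "y \<in> Y" for X Y x y
      using k[OF that] r[OF that(1), of x] r[OF that(1), of y] that by simp
  qed
qed

text \<open>In a live pair, a vertex of the second set is adjacent to all earlier vertices of the
  first, while a vertex of the first set is adjacent to no earlier vertex of the second.\<close>

lemma tame_step:
  assumes r: "\<And>X Y x y. (X, Y) \<in> live \<Longrightarrow> x \<in> X \<Longrightarrow> y \<in> Y \<Longrightarrow>
      (E x y \<longleftrightarrow> r x < r y) \<and> r x \<noteq> (r y :: nat)"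
    and "tame X Y" "u \<in> X" "v \<in> X" "w \<in> Y" "r u \<le> r w" "r v \<le> r w" "E u w"
  shows "E v w"
proof -
  consider "homogeneous X Y" | Z where "(X, Z) \<in> live" "Y \<subseteq> Z" | Z where "(Y, Z) \<in> live" "X \<subseteq> Z"
    using assms(2) unfolding tame_def by blast
  then show ?thesis
  proof cases
    case 1
    then show ?thesis
      using assms unfolding homogeneous_def by blast
  next
    case 2
    then have "E v w \<longleftrightarrow> r v < r w" "r v \<noteq> r w"
      using r[of X Z v w] assms by auto
    then show ?thesis
      using assms by simp
  next
    case 3
    then have "E w u \<longleftrightarrow> r w < r u"
      using r[of Y Z w u] assms by auto
    then show ?thesis
      using assms E_sym by fastforce
  qed
qed

lemma ranked_labelling:
  obtains lab r :: "'a \<Rightarrow> nat"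
  where "\<And>v. v \<in> V \<Longrightarrow> lab v < 26"
    and "\<And>u v w. u \<in> V \<Longrightarrow> v \<in> V \<Longrightarrow> w \<in> V \<Longrightarrow> lab u = lab v \<Longrightarrow> r u \<le> r w \<Longrightarrow> r v \<le> r w \<Longrightarrow>
      E u w \<Longrightarrow> E v w"
proof -
  obtain r :: "'a \<Rightarrow> nat" where
    r: "\<And>X Y x y. (X, Y) \<in> live \<Longrightarrow> x \<in> X \<Longrightarrow> y \<in> Y \<Longrightarrow> (E x y \<longleftrightarrow> r x < r y) \<and> r x \<noteq> r y"
    using rank_exists by blast
  obtain num where num: "bij_betw num parts {0..<card parts}"
    using ex_bij_betw_finite_nat[OF card_parts(1)] by blast
  have "\<exists>P. v \<in> V \<longrightarrow> P \<in> parts \<and> v \<in> P" for v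
    using Union_parts by blast
  then obtain part where part: "part v \<in> parts" "v \<in> part v" if "v \<in> V" for v
    by metis
  show thesis
  proof (rule that[of "num \<circ> part" r])
    show "(num \<circ> part) v < 26" if "v \<in> V" for v
      using bij_betw_apply[OF num part(1)[OF that]] card_parts(2) by simp
    show "E v w" if "u \<in> V" "v \<in> V" "w \<in> V" "(num \<circ> part) u = (num \<circ> part) v"
      "r u \<le> r w" "r v \<le> r w" "E u w" for u v w
    proof -
      have "part u = part v"
        using num that part by (auto simp: bij_betw_def inj_on_def)
      then have "u \<in> part v" "v \<in> part v" "w \<in> part w"
        using part that by metis+
      then show ?thesis
      proof (rule tame_step[where r = r and X = "part v" and Y = "part w" and u = u, rotated 2])
        show "tame (part v) (part w)"
          using part that by (intro tame_parts)
      qed (use r that in simp_all)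
    qed
  qed
qed

end

section \<open>Closed adjacency of a graph\<close>

lemma all_less_4: "(\<forall>i < (4::nat). P i) \<longleftrightarrow> P 0 \<and> P 1 \<and> P 2 \<and> P 3"
  by (simp add: numeral_eq_Suc All_less_Suc) auto

lemma all_less_6: "(\<forall>i < (6::nat). P i) \<longleftrightarrow> P 0 \<and> P 1 \<and> P 2 \<and> P 3 \<and> P 4 \<and> P 5"
  by (simp add: numeral_eq_Suc All_less_Suc) auto

definition close :: "'a pair_pre_digraph \<Rightarrow> 'a \<Rightarrow> 'a \<Rightarrow> bool" where
  "close G u v \<longleftrightarrow> u = v \<or> (u, v) \<in> parcs G"

text \<open>Neither graph has loops, so reflexive adjacency determines the arcs.\<close>

lemma contains_induced_close:
  assumes "pair_graph G"
    and n: "length xs = n"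
    and F: "pverts F = {..<n}" "parcs F \<subseteq> {..<n} \<times> {..<n}" "irrefl (parcs F)"
    and "distinct xs" "set xs \<subseteq> pverts G"
    and close: "\<forall>i < n. \<forall>j < n. close G (xs ! i) (xs ! j) \<longleftrightarrow> i = j \<or> (i, j) \<in> parcs F"
  shows "contains_induced G F"
proof (rule contains_induced_list[where xs = xs])
  interpret pair_graph G
    by fact
  show "pair_wf_digraph G"
    by unfold_locales
  have "(v, v) \<notin> parcs G" for v
    using pair_no_loops[of "(v, v)"] by auto
  then show "(xs ! i, xs ! j) \<in> parcs G \<longleftrightarrow> (i, j) \<in> parcs F" if "i < length xs" "j < length xs" for i j
    using close[rule_format, of i j] that F(3) \<open>distinct xs\<close> n
    by (cases "i = j") (auto simp: close_def irrefl_def nth_eq_iff_index_eq)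
qed (use assms in simp_all)

text \<open>A violated condition of the locale yields a list of vertices that induces a forbidden
  graph.\<close>

lemma hexagon_graph_close:
  assumes G: "pair_graph G"
    and free: "induced_free {edgeless_graph 4, cycle_graph 4, path_graph 6} G"
    and C6: "contains_induced G (cycle_graph 6)"
  obtains h where "hexagon_graph (pverts G) (close G) h"
proof -
  interpret pair_graph G
    by fact
  have close_sym: "close G u v \<longleftrightarrow> close G v u" for u v
    using arcs_symmetric by (auto simp: close_def)
  have close_in: "u \<in> pverts G" if "close G u v" "u \<noteq> v" for u v
    using that by (auto simp: close_def dest: in_arcsD1)
  have close_refl: "close G u u" for u
    by (simp add: close_def)
  obtain f where f: "inj_on f {..<6}" "f ` {..<6} \<subseteq> pverts G"
    "\<And>i j. i < 6 \<Longrightarrow> j < 6 \<Longrightarrow> (f i, f j) \<in> parcs G \<longleftrightarrow> (i, j) \<in> parcs (cycle_graph 6)"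
    using contains_inducedE[OF C6] by (auto simp: cycle_graph_def)
  have f_close: "close G (f i) (f j) \<longleftrightarrow> i = j \<or> (i, j) \<in> parcs (cycle_graph 6)" if "i < 6" "j < 6" for i j
    using f that by (auto simp: close_def inj_on_def)
  define h :: "6 \<Rightarrow> 'a" where "h i = (if i = 0 then f 0 else if i = 1 then f 1 else
     if i = 2 then f 2 else if i = 3 then f 3 else if i = 4 then f 4 else f 5)" for i
  have "hexagon_graph (pverts G) (close G) h"
  proof
    show "finite (pverts G)"
      by (rule pair_finite_verts)
    show "close G x x" for x
      by (simp add: close_def)
    show "close G x y \<Longrightarrow> close G y x" for x y
      using close_sym by blast
    show "close G p r \<or> close G q s" if "close G p q" "close G q r" "close G r s" "close G s p" for p q r s
    proof (rule ccontr)
      assume not: "\<not> ?thesis"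
      \<comment> \<open>Equal vertices would make one of the excluded pairs close.\<close>
      have "distinct [p, q, r, s]"
        using not that close_refl close_sym by auto
      \<comment> \<open>Closeness of distinct vertices is an arc, whose ends are vertices of
        \<open>G\<close>.\<close>
      moreover from this have "set [p, q, r, s] \<subseteq> pverts G"
        using close_in[of p q] close_in[of q r] close_in[of r s] close_in[of s r] that close_sym by auto
      ultimately have "contains_induced G (cycle_graph 4)"
        using not that close_sym close_refl
        by (intro contains_induced_close[OF G, where xs = "[p, q, r, s]" and n = 4])
          (auto simp: cycle_graph_def all_less_4 irrefl_def)
      then show False
        using free by (simp add: induced_free_def)
    qed
    show "close G p q \<or> close G p r \<or> close G p s \<or> close G q r \<or> close G q s \<or> close G r s"
      if "p \<in> pverts G" "q \<in> pverts G" "r \<in> pverts G" "s \<in> pverts G" for p q r s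
    proof (rule ccontr)
      assume not: "\<not> ?thesis"
      have "distinct [p, q, r, s]"
        using not that close_refl close_sym by auto
      moreover from this have "set [p, q, r, s] \<subseteq> pverts G"
        using that by auto
      ultimately have "contains_induced G (edgeless_graph 4)"
        using not that close_sym close_refl
        by (intro contains_induced_close[OF G, where xs = "[p, q, r, s]" and n = 4])
          (auto simp: edgeless_graph_def all_less_4 irrefl_def)
      then show False
        using free by (simp add: induced_free_def)
    qed
    show "close G p r \<or> close G p s \<or> close G p t \<or> close G p u \<or> close G q s \<or> close G q t \<or>
        close G q u \<or> close G r t \<or> close G r u \<or> close G s u"
      if "close G p q" "close G q r" "close G r s" "close G s t" "close G t u" for p q r s t u
    proof (rule ccontr)
      assume not: "\<not> ?thesis"
      have "distinct [p, q, r, s, t, u]"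
        using not that close_refl close_sym by auto
      moreover from this have "set [p, q, r, s, t, u] \<subseteq> pverts G"
        using close_in[of p q] close_in[of q r] close_in[of r s] close_in[of s t] close_in[of t u] close_in[of u t] that close_sym by auto
      ultimately have "contains_induced G (path_graph 6)"
        using not that close_sym close_refl
        by (intro contains_induced_close[OF G, where xs = "[p, q, r, s, t, u]" and n = 6])
          (auto simp: path_graph_def all_less_6 irrefl_def)
      then show False
        using free by (simp add: induced_free_def)
    qed
    show "h i \<in> pverts G" for i
      using f(2) by (auto simp: h_def)
    show "close G (h i) (h (i + 1))" "\<not> close G (h i) (h (i + 2))" "\<not> close G (h i) (h (i + 3))" for i
      using six_cases[of i] f_close by (auto simp: h_def cycle_graph_def)
  qed
  then show thesis
    by (rule that)
qed

text \<open>One label for each of at most 26 parts, and the spare label of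
  \<open>cw_built_ranked\<close>.\<close>

lemma clique_width_le_27:
  assumes G: "pair_graph G"
    and free: "induced_free {edgeless_graph 4, cycle_graph 4, path_graph 6} G"
    and C6: "contains_induced G (cycle_graph 6)"
  shows "clique_width G \<le> 27"
proof -
  interpret pair_graph G
    by fact
  obtain h where "hexagon_graph (pverts G) (close G) h"
    using hexagon_graph_close[OF assms] .
  then interpret hexagon_graph "pverts G" "close G" h .
  obtain lab r :: "'a \<Rightarrow> nat" where lab: "\<And>v. v \<in> pverts G \<Longrightarrow> lab v < 26"
    and r: "\<And>u v w. u \<in> pverts G \<Longrightarrow> v \<in> pverts G \<Longrightarrow> w \<in> pverts G \<Longrightarrow> lab u = lab v \<Longrightarrow>
      r u \<le> r w \<Longrightarrow> r v \<le> r w \<Longrightarrow> close G u w \<Longrightarrow> close G v w"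
    by (rule ranked_labelling) metis
  have "pverts G \<noteq> {}"
    using h_in by blast
  moreover have "sym (parcs G)"
    using arcs_symmetric by (auto intro: symI)
  moreover have "irrefl (parcs G)"
    using pair_no_loops by (force simp: irrefl_def)
  moreover have "(v, w) \<in> parcs G" if "u \<in> pverts G" "v \<in> pverts G" "w \<in> pverts G" "lab u = lab v"
    "w \<noteq> u" "w \<noteq> v" "r u \<le> r w" "r v \<le> r w" "(u, w) \<in> parcs G" for u v w
    using r[of u v w] that by (auto simp: close_def)
  ultimately obtain l where
    "cw_built (Suc 26) \<lparr>pverts = pverts G, parcs = parcs G \<inter> pverts G \<times> pverts G\<rparr> l"
    using cw_built_ranked[OF fin, of "parcs G" lab 26 r] lab by blast
  moreover have "parcs G \<inter> pverts G \<times> pverts G = parcs G"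
    by (auto dest: in_arcsD1 in_arcsD2)
  then have "\<lparr>pverts = pverts G, parcs = parcs G \<inter> pverts G \<times> pverts G\<rparr> = G"
    by (cases G) simp
  moreover have "Suc 26 = 27"
    by simp
  ultimately have "\<exists>l. cw_built 27 G l"
    by metis
  then have "clique_width G \<le> enat 27"
    unfolding clique_width_def by (intro Inf_lower) blast
  then show ?thesis
    by (simp add: numeral_eq_enat)
qed

theorem theorem2p4:
  shows "(\<forall>G :: 'a pair_pre_digraph.
            pair_graph G \<and>
            induced_free {edgeless_graph 4, cycle_graph 4, path_graph 6} G \<and>
            contains_induced G (cycle_graph 6)
            \<longrightarrow> clique_width G \<le> 27) \<and>
         bounded_clique_width
           {G :: 'a pair_pre_digraph.
              pair_graph G \<and>
              induced_free {edgeless_graph 4, cycle_graph 4, path_graph 6} G \<and>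
              contains_induced G (cycle_graph 6)}"
proof -
  have "clique_width G \<le> 27 \<and> clique_width G \<le> enat 27"
    if "pair_graph G" "induced_free {edgeless_graph 4, cycle_graph 4, path_graph 6} G"
      "contains_induced G (cycle_graph 6)" for G :: "'a pair_pre_digraph"
    using clique_width_le_27[OF that] by (simp add: numeral_eq_enat)
  then show ?thesis
    unfolding bounded_clique_width_def by blast
qed

end
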